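(* Let $k\ge2$ and set $F(\zeta_1,\dots,\zeta_k)=\exp\left(\frac{\zeta_1+\zeta_2+2}{\zeta_1+\zeta_2-2}\right)$ for $(\zeta_1,\dots,\zeta_k)\in\mathbb D^k$. Then $F$ is outer on $\mathbb D^k$, but $F$ is not strongly outer on $\mathbb D^k$.
   Context: $\mathbb D$ is the open unit disc. $H^\infty(U)$ denotes the algebra of bounded holomorphic functions on an open set $U\subset\mathbb C^k$. A function $G\in H^\infty(\mathbb D^k)$ is outer if $\log|G(0,\dots,0)|=\frac1{(2\pi)^k}\int_{[0,2\pi]^k}\log|G^*(e^{it_1},\dots,e^{it_k})|\,dt_1\cdots dt_k$, where $G^*$ denotes the a.e. defined nontangential limit of $G$ on the torus. For a connected open set $U\subset\mathbb C^k$, $F\in H^\infty(U)$ is strongly outer on $U$ if there exists a sequence $(F_n)_{n\ge1}$ of invertible elements of $H^\infty(U)$ such that $|F(\zeta)|\le|F_n(\zeta)|$ for $\zeta\in U$, $n\ge1$, and $\lim_{n\to\infty}F(\zeta)F_n(\zeta)^{-1}=1$ for every $\zeta\in U$. *)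

theory Defs
  imports "HOL-Analysis.Analysis"
begin

text \<open>Holomorphy in several variables: Frechet differentiability with a
  complex-linear derivative at every point (for open \<open>U\<close>).\<close>

definition holomorphic_multi :: "(complex ^ 'n::finite) set \<Rightarrow> (complex ^ 'n \<Rightarrow> complex) \<Rightarrow> bool" where
  "holomorphic_multi U f \<longleftrightarrow>
     (\<forall>z\<in>U. \<exists>D. (f has_derivative D) (at z) \<and> (\<forall>c v. D (c *s v) = c * D v))"

text \<open>Elements are total functions that matter only on \<open>U\<close>; hence invertibility in the
  algebra is expressed by an identity on \<open>U\<close>.\<close>

definition Hinf :: "(complex ^ 'n::finite) set \<Rightarrow> (complex ^ 'n \<Rightarrow> complex) set" where
  "Hinf U = {f. holomorphic_multi U f \<and> bounded (f ` U)}"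

definition Hinf_invertible :: "(complex ^ 'n::finite) set \<Rightarrow> (complex ^ 'n \<Rightarrow> complex) \<Rightarrow> bool" where
  "Hinf_invertible U f \<longleftrightarrow> f \<in> Hinf U \<and> (\<exists>g\<in>Hinf U. \<forall>z\<in>U. f z * g z = 1)"

definition polydisc :: "(complex ^ 'n::finite) set" where
  "polydisc = {z. \<forall>i. z $ i \<in> ball 0 1}"

lemma open_polydisc: "open (polydisc :: (complex ^ 'n::finite) set)"
proof -
  have "polydisc = (\<Inter>i. (\<lambda>z :: complex ^ 'n. z $ i) -` ball 0 1)"
    by (auto simp: polydisc_def)
  moreover have "open ((\<lambda>z :: complex ^ 'n. z $ i) -` ball 0 1)" for i
    by (intro open_vimage open_ball continuous_intros)
  ultimately show ?thesis
    by (metis (no_types, lifting) finite_class.finite_UNIV open_INT)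
qed

lemma connected_polydisc: "connected (polydisc :: (complex ^ 'n::finite) set)"
proof (rule convex_connected, rule convexI)
  fix x y :: "complex ^ 'n" and u v :: real
  assume "x \<in> polydisc" "y \<in> polydisc" "0 \<le> u" "0 \<le> v" "u + v = 1"
  then show "u *\<^sub>R x + v *\<^sub>R y \<in> polydisc"
    using convexD[OF convex_ball[of "0::complex" 1]] by (auto simp: polydisc_def)
qed

text \<open>For a point \<open>w\<close> of the torus, each coordinate of \<open>z\<close> lies in a Stolz region at the
  corresponding coordinate of \<open>w\<close>. The coordinates may approach the boundary at unrelated rates.\<close>

definition stolz :: "real \<Rightarrow> complex ^ 'n::finite \<Rightarrow> (complex ^ 'n) set" where
  "stolz M w = {z \<in> polydisc. \<forall>i. cmod (z $ i - w $ i) < M * (1 - cmod (z $ i))}"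

definition nontangential :: "complex ^ 'n::finite \<Rightarrow> (complex ^ 'n) filter" where
  "nontangential w = (SUP M\<in>{1<..}. at w within stolz M w)"

lemma tendsto_nontangential_iff:
  "(G \<longlongrightarrow> l) (nontangential w) \<longleftrightarrow> (\<forall>M>1. (G \<longlongrightarrow> l) (at w within stolz M w))"
  by (auto simp: nontangential_def filterlim_def filtermap_SUP SUP_le_iff)

definition boundary_value :: "(complex ^ 'n::finite \<Rightarrow> complex) \<Rightarrow> complex ^ 'n \<Rightarrow> complex" where
  "boundary_value G w = Lim (nontangential w) G"

definition torus_point :: "real ^ 'n::finite \<Rightarrow> complex ^ 'n" where
  "torus_point t = (\<chi> j. cis (t $ j))"

text \<open>For \<open>G \<in> Hinf polydisc\<close> the nontangential limit exists almost everywhere, and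
  \<open>log |G*|\<close> is integrable unless \<open>G\<close> vanishes identically; both facts are included so that
  neither the default value of \<open>Lim\<close> nor that of a non-existing integral can enter. The clause
  \<open>G 0 \<noteq> 0\<close> is needed because \<open>ln 0 = 0\<close> in HOL, where the definition means minus infinity.\<close>

definition outer_fun :: "(complex ^ 'n::finite \<Rightarrow> complex) \<Rightarrow> bool" where
  "outer_fun G \<longleftrightarrow>
     G \<in> Hinf polydisc \<and> G 0 \<noteq> 0 \<and>
     (AE t in lebesgue. \<exists>l. (G \<longlongrightarrow> l) (nontangential (torus_point t))) \<and>
     set_integrable lebesgue (cbox 0 (\<chi> j. 2 * pi))
       (\<lambda>t. ln (cmod (boundary_value G (torus_point t)))) \<and>
     ln (cmod (G 0)) =
       1 / (2 * pi) ^ CARD('n) *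
       (LINT t:cbox 0 (\<chi> j. 2 * pi)|lebesgue. ln (cmod (boundary_value G (torus_point t))))"

definition strongly_outer :: "(complex ^ 'n::finite) set \<Rightarrow> (complex ^ 'n \<Rightarrow> complex) \<Rightarrow> bool" where
  "strongly_outer U F \<longleftrightarrow>
     F \<in> Hinf U \<and>
     (\<exists>Fn :: nat \<Rightarrow> complex ^ 'n \<Rightarrow> complex.
        (\<forall>n\<ge>1. Hinf_invertible U (Fn n)) \<and>
        (\<forall>z\<in>U. \<forall>n\<ge>1. cmod (F z) \<le> cmod (Fn n z)) \<and>
        (\<forall>z\<in>U. (\<lambda>n. F z * inverse (Fn n z)) \<longlonglongrightarrow> 1))"

end

theory Submission
  imports Defs "HOL-Complex_Analysis.Conformal_Mappings" "HOL-Library.Real_Mod"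
begin

text \<open>Put \<open>x = \<zeta>\<^sub>1 + \<zeta>\<^sub>2\<close>, so that \<open>- log |F| = Re ((2 + x) / (2 - x)) \<ge> 0\<close>. For a fixed
  \<open>\<zeta>\<^sub>1 \<noteq> 1\<close> on the circle this is the real part of a function of \<open>\<zeta>\<^sub>2\<close> holomorphic on the closed
  disc, with mean \<open>Re ((2 + \<zeta>\<^sub>1) / (2 - \<zeta>\<^sub>1))\<close>, whose mean over \<open>\<zeta>\<^sub>1\<close> is 1; by Tonelli
  \<open>F\<close> is outer. On the diagonal, however, \<open>F\<close> is the singular inner function
  \<open>exp ((z + 1) / (z - 1))\<close>. If \<open>F\<^sub>n\<close> is invertible with \<open>|F| \<le> |F\<^sub>n|\<close>, then \<open>1 / F\<^sub>n\<close> restricted to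
  the diagonal is bounded and dominated by the exponential of the Poisson kernel at 1, and a
  Phragmen-Lindelof argument gives \<open>|F\<^sub>n(0)| \<ge> 1\<close>. Hence \<open>|F(0) / F\<^sub>n(0)| \<le> 1 / e\<close> for all \<open>n\<close>.\<close>


section \<open>Almost everywhere equality, and Tonelli on boxes\<close>

text \<open>In a complete measure space a set that differs from a measurable one by a null set is
  measurable. This serves \<open>boundary_value\<close>, which is computed only almost
  everywhere.\<close>

lemma (in complete_measure) measurable_AE_eq:
  assumes f: "f \<in> M \<rightarrow>\<^sub>M N" and ae: "AE x in M. f x = g x" and g: "g \<in> space M \<rightarrow> space N"
  shows "g \<in> M \<rightarrow>\<^sub>M N"
proof (rule measurableI)
  fix A assume A: "A \<in> sets N"
  show "g -` A \<inter> space M \<in> sets M"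
  proof (rule in_sets_AE)
    show "AE x in M. (x \<in> f -` A \<inter> space M) = (x \<in> g -` A \<inter> space M)"
      using ae by eventually_elim auto
    show "f -` A \<inter> space M \<in> sets M" using f A by (rule measurable_sets)
  qed auto
qed (use g in auto)

text \<open>\<open>lborel\<close> is the image of a product measure indexed by \<open>Basis\<close>,
  so Tonelli peels off the coordinates \<open>p\<close> and \<open>q\<close>, while every other
  coordinate only contributes its side length as a factor.\<close>

lemma nn_integral_cbox_two_coords:
  fixes u v :: "'a::euclidean_space" and g :: "real \<Rightarrow> real \<Rightarrow> ennreal"
  assumes p: "p \<in> Basis" and q: "q \<in> Basis" and pq: "p \<noteq> q"
    and g: "case_prod g \<in> borel_measurable borel"
  shows "(\<integral>\<^sup>+t. g (t \<bullet> p) (t \<bullet> q) * indicator (cbox u v) t \<partial>lborel) =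
    (\<integral>\<^sup>+y. (\<integral>\<^sup>+z. g y z * indicator {u \<bullet> q..v \<bullet> q} z \<partial>lborel)
        * indicator {u \<bullet> p..v \<bullet> p} y \<partial>lborel)
      * (\<Prod>b\<in>Basis - {p, q}. emeasure lborel {u \<bullet> b..v \<bullet> b})"
proof -
  interpret product_sigma_finite "\<lambda>_::'a. lborel :: real measure" ..
  define J where "J = Basis - {p, q}"
  define \<iota> :: "'a \<Rightarrow> real \<Rightarrow> ennreal" where "\<iota> = (\<lambda>b. indicator {u \<bullet> b..v \<bullet> b})"
  have [measurable]: "\<iota> b \<in> borel_measurable borel" for b
    by (simp add: \<iota>_def)
  have [measurable]: "(\<lambda>x. g (f x) (h x)) \<in> borel_measurable M"
    if "f \<in> borel_measurable M" "h \<in> borel_measurable M" for f h and M :: "'b measure"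
    using measurable_compose[OF borel_measurable_Pair[OF that] g] by simp
  have [measurable]: "g y \<in> borel_measurable borel" for y
    by measurable
  have J: "finite J" "p \<notin> J" "q \<notin> J" "Basis = insert p (insert q J)"
    using p q by (auto simp: J_def)
  have ind: "indicator (cbox u v) t = (\<Prod>b\<in>Basis. \<iota> b (t \<bullet> b))" for t
    by (auto simp: \<iota>_def cbox_def split: split_indicator)
  have lb: "(lborel :: 'a measure) =
      distr (\<Pi>\<^sub>M b\<in>Basis. lborel) borel (\<lambda>f. \<Sum>b\<in>Basis. f b *\<^sub>R b)"
    by (rule lborel_eq)
  \<comment> \<open>\<open>f\<close> is the integrand on the product space; \<open>h y\<close> is
    what is left of it once the coordinate \<open>p\<close> is frozen at \<open>y\<close>.\<close>
  define f where "f x = g (x p) (x q) * (\<iota> p (x p) * (\<iota> q (x q) * (\<Prod>b\<in>J. \<iota> b (x b))))" for x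
  define h where "h y x = g y (x q) * (\<iota> p y * (\<iota> q (x q) * (\<Prod>b\<in>J. \<iota> b (x b))))" for y x
  have [measurable]: "f \<in> borel_measurable (\<Pi>\<^sub>M b\<in>insert p (insert q J). lborel)"
    unfolding f_def by measurable
  have [measurable]: "h y \<in> borel_measurable (\<Pi>\<^sub>M b\<in>insert q J. lborel)" for y
    unfolding h_def by measurable
  have upd: "(\<Prod>b\<in>J. \<iota> b ((x(r := y)) b)) = (\<Prod>b\<in>J. \<iota> b (x b))" if "r \<notin> J" for r x y
    using that by (intro prod.cong) auto
  have f_upd: "f (x(p := y)) = h y x" and
    h_upd: "h y (x(q := z)) = g y z * (\<iota> p y * (\<iota> q z * (\<Prod>b\<in>J. \<iota> b (x b))))" for x y z
    using pq J by (simp_all add: f_def h_def upd del: fun_upd_apply) (simp_all)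
  have "(\<integral>\<^sup>+t. g (t \<bullet> p) (t \<bullet> q) * indicator (cbox u v) t \<partial>lborel) =
      (\<integral>\<^sup>+x. g (x p) (x q) * (\<Prod>b\<in>Basis. \<iota> b (x b)) \<partial>(\<Pi>\<^sub>M b\<in>Basis. lborel))"
    unfolding ind by (subst lb, subst nn_integral_distr) (simp_all add: p q)
  also have "\<dots> = integral\<^sup>N (\<Pi>\<^sub>M b\<in>insert p (insert q J). lborel) f"
    unfolding J(4) f_def using J(1-3) pq by simp
  also have "\<dots> = (\<integral>\<^sup>+y. \<integral>\<^sup>+x. h y x \<partial>(\<Pi>\<^sub>M b\<in>insert q J. lborel) \<partial>lborel)"
    unfolding f_upd[symmetric] by (rule product_nn_integral_insert_rev) (use J(1-3) pq in auto)
  also have "\<dots> = (\<integral>\<^sup>+y. \<integral>\<^sup>+z. \<integral>\<^sup>+x. g y z * (\<iota> p y * (\<iota> q z * (\<Prod>b\<in>J. \<iota> b (x b))))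
      \<partial>(\<Pi>\<^sub>M b\<in>J. lborel) \<partial>lborel \<partial>lborel)"
    unfolding h_upd[symmetric]
    by (intro nn_integral_cong product_nn_integral_insert_rev) (use J(1-3) in auto)
  also have "\<dots> = (\<integral>\<^sup>+y. \<integral>\<^sup>+z. g y z * (\<iota> p y * (\<iota> q z * (\<Prod>b\<in>J. integral\<^sup>N lborel (\<iota> b))))
      \<partial>lborel \<partial>lborel)"
    using J by (simp add: nn_integral_cmult product_nn_integral_prod)
  also have "\<dots> = (\<integral>\<^sup>+y. \<integral>\<^sup>+z. (\<Prod>b\<in>J. integral\<^sup>N lborel (\<iota> b)) * (\<iota> p y * (g y z * \<iota> q z))
      \<partial>lborel \<partial>lborel)"
    by (simp add: mult_ac)
  also have "\<dots> = (\<Prod>b\<in>J. integral\<^sup>N lborel (\<iota> b)) * (\<integral>\<^sup>+y. \<iota> p y * (\<integral>\<^sup>+z. g y z * \<iota> q z \<partial>lborel) \<partial>lborel)"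
    by (simp add: nn_integral_cmult)
  finally show ?thesis
    by (simp add: \<iota>_def J_def mult_ac)
qed

section \<open>Mean values over the circle\<close>

text \<open>Cauchy's integral formula at the centre, with the circle parametrised by
  \<open>cis\<close>: dz / z becomes i dt, and the factor i is cancelled at the end.\<close>

lemma has_integral_circle_mean:
  assumes "f holomorphic_on cball 0 1"
  shows "((\<lambda>s. f (cis s)) has_integral 2 * of_real pi * f 0) {0..2 * pi}"
proof -
  have "((\<lambda>u. f u / (u - 0)) has_contour_integral (2 * of_real pi * \<i> * f 0)) (circlepath 0 1)"
    by (rule Cauchy_integral_circlepath_simple[OF assms]) simp
  then have "((\<lambda>t. f (cis t) / cis t * \<i> * cis t) has_integral 2 * of_real pi * \<i> * f 0) {0..2 * pi}"
    unfolding circlepath_def by (subst (asm) has_contour_integral_part_circlepath_iff) auto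
  then have "((\<lambda>t. f (cis t) * \<i>) has_integral 2 * of_real pi * f 0 * \<i>) {0..2 * pi}"
    by (simp add: field_simps)
  from has_integral_mult_left[OF this, of "-\<i>"] show ?thesis
    by (simp add: mult.assoc)
qed

text \<open>Real part of the mean value property. Nonnegativity on the circle keeps
  \<open>ennreal\<close> from truncating the integrand, so that the identity can feed
  Tonelli.\<close>

lemma nn_integral_circle_mean:
  assumes f: "f holomorphic_on cball 0 1" and nn: "\<And>s. 0 \<le> Re (f (cis s))"
  shows "(\<integral>\<^sup>+s. ennreal (Re (f (cis s))) * indicator {0..2 * pi} s \<partial>lborel) = ennreal (2 * pi * Re (f 0))"
proof -
  have int: "((\<lambda>s. Re (f (cis s))) has_integral 2 * pi * Re (f 0)) {0..2 * pi}"
    using has_integral_linear[OF has_integral_circle_mean[OF f] bounded_linear_Re]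
    by (simp add: o_def mult.assoc)
  have cont: "continuous_on UNIV (\<lambda>s. Re (f (cis s)))"
    by (intro continuous_intros continuous_on_compose2[OF holomorphic_on_imp_continuous_on[OF f]])
      auto
  have "((\<lambda>s. indicator {0..2 * pi} s * Re (f (cis s))) has_integral 2 * pi * Re (f 0)) UNIV"
    using int by (subst (asm) has_integral_restrict_UNIV[symmetric])
      (auto elim!: has_integral_eq[rotated] split: split_indicator)
  from nn_integral_has_integral_lborel[OF _ _ this]
  have "(\<integral>\<^sup>+s. ennreal (indicator {0..2 * pi} s * Re (f (cis s))) \<partial>lborel) = ennreal (2 * pi * Re (f 0))"
    using nn borel_measurable_continuous_onI[OF cont] by (simp split: split_indicator)
  then show ?thesis
    by (simp add: ennreal_mult' mult.commute ennreal_indicator nn)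
qed

section \<open>The Poisson kernel and a Phragmen-Lindelof estimate\<close>

text \<open>For \<open>c = 1\<close> this is the Poisson kernel of the unit disc at 1;
  \<open>c = 2\<close> serves the sum of two coordinates. At \<open>x = c\<close> both sides are 0,
  as division by zero yields 0.\<close>

lemma Re_cayley:
  fixes c :: real and x :: complex
  shows "Re ((c + x) / (c - x)) = (c\<^sup>2 - (cmod x)\<^sup>2) / (cmod (c - x))\<^sup>2"
  unfolding Re_divide cmod_power2 by (simp add: power2_eq_square algebra_simps)

text \<open>The hypothesis degenerates only at the boundary point 1, where the factor \<open>(1 - z) / 2\<close>
  absorbs the crude bound; taking powers \<open>g ^ m\<close> makes its value at 0 irrelevant.\<close>

lemma norm_le_one_of_le_exp_Poisson:
  assumes g: "g holomorphic_on ball 0 1"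
    and bdd: "\<And>z. z \<in> ball 0 1 \<Longrightarrow> cmod (g z) \<le> C"
    and le: "\<And>z. z \<in> ball 0 1 \<Longrightarrow> cmod (g z) \<le> exp (Re ((1 + z) / (1 - z)))"
  shows "cmod (g 0) \<le> 1"
proof -
  define K where "K = max C 1"
  have K: "K \<ge> 1" "\<And>z. z \<in> ball 0 1 \<Longrightarrow> cmod (g z) \<le> K"
    using bdd by (auto simp: K_def intro: order_trans[OF bdd])
  \<comment> \<open>The 2 is the inverse of the factor \<open>(1 - z) / 2\<close> at the origin.
    Since it does not depend on \<open>m\<close>, it rules out
    \<open>cmod (g 0) > 1\<close>.\<close>
  have *: "cmod (g 0) ^ m \<le> 2" for m
  proof -
    \<comment> \<open>Chosen so that within distance \<delta> of 1 the factor
      \<open>(1 - z) / 2\<close> offsets the crude bound \<open>K ^ m\<close>.\<close>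
    define \<delta> where "\<delta> = 1 / K ^ m"
    have \<delta>: "0 < \<delta>" "K ^ m * \<delta> = 1" using K(1) by (auto simp: \<delta>_def)
    \<comment> \<open>Maximum modulus on the circle of radius \<open>r\<close>: at distance at least
      \<delta> from 1 the Poisson kernel is at most
      \<open>(1 - r\<^sup>2) / \<delta>\<^sup>2\<close>, which tends to 0 as \<open>r\<close> tends
      to 1 with \<open>m\<close> and \<delta> fixed.\<close>
    have "cmod (g 0 ^ m * ((1 - 0) / 2)) \<le> exp (m * ((1 - r\<^sup>2) / \<delta>\<^sup>2))"
      if r: "0 < r" "r < 1" for r
    proof (rule maximum_modulus_frontier[where S="cball 0 r" and f="\<lambda>z. g z ^ m * ((1 - z) / 2)"])
      have "g holomorphic_on cball 0 r"
        using g by (rule holomorphic_on_subset) (use r in auto)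
      then have "(\<lambda>z. g z ^ m * ((1 - z) / 2)) holomorphic_on cball 0 r"
        by (intro holomorphic_intros) auto
      then show "continuous_on (closure (cball 0 r)) (\<lambda>z. g z ^ m * ((1 - z) / 2))"
        "(\<lambda>z. g z ^ m * ((1 - z) / 2)) holomorphic_on interior (cball 0 r)"
        by (auto intro: holomorphic_on_imp_continuous_on holomorphic_on_subset)
      fix z :: complex assume "z \<in> frontier (cball 0 r)"
      then have z: "cmod z = r" "z \<in> ball 0 1" using r by auto
      have E: "1 \<le> exp (m * ((1 - r\<^sup>2) / \<delta>\<^sup>2))"
        using r by (auto intro!: mult_nonneg_nonneg divide_nonneg_nonneg simp: power_le_one)
      show "cmod (g z ^ m * ((1 - z) / 2)) \<le> exp (m * ((1 - r\<^sup>2) / \<delta>\<^sup>2))"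
      proof (cases "cmod (1 - z) < \<delta>")
        case True
        have "cmod (g z ^ m * ((1 - z) / 2)) \<le> K ^ m * \<delta>"
          unfolding norm_mult norm_power norm_divide
          using True \<delta>(1) K z(2) by (intro mult_mono power_mono) auto
        then show ?thesis using \<delta>(2) E by linarith
      next
        case False
        have "cmod (1 - z) \<le> 2"
          using norm_triangle_ineq4[of 1 z] z r by simp
        then have "cmod (g z ^ m * ((1 - z) / 2)) \<le> exp (Re ((1 + z) / (1 - z))) ^ m * 1"
          unfolding norm_mult norm_power norm_divide
          using le z(2) by (intro mult_mono power_mono) auto
        also have "\<dots> = exp (m * ((1 - r\<^sup>2) / (cmod (1 - z))\<^sup>2))"
          using Re_cayley[of 1 z] z by (simp add: exp_of_nat_mult[symmetric])
        also have "\<dots> \<le> exp (m * ((1 - r\<^sup>2) / \<delta>\<^sup>2))"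
          using False \<delta>(1) r
          by (auto intro!: mult_left_mono divide_left_mono power_mono mult_pos_pos simp: power_le_one)
        finally show ?thesis .
      qed
    qed (use r in auto)
    then have ev: "\<forall>\<^sub>F r in at_left 1. cmod (g 0) ^ m / 2 \<le> exp (m * ((1 - r\<^sup>2) / \<delta>\<^sup>2))"
      by (auto simp: eventually_at_left_field norm_mult norm_power norm_divide intro!: exI[of _ 0])
    have "((\<lambda>r. exp (m * ((1 - r\<^sup>2) / \<delta>\<^sup>2))) \<longlongrightarrow> exp (m * ((1 - 1\<^sup>2) / \<delta>\<^sup>2))) (at_left (1::real))"
      using \<delta>(1) by (intro tendsto_intros) auto
    from tendsto_lowerbound[OF this ev] show ?thesis by simp
  qed
  show ?thesis
  proof (rule ccontr)
    assume "\<not> ?thesis"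
    then obtain m where "2 < cmod (g 0) ^ m" using real_arch_pow[of "cmod (g 0)" 2] by auto
    with *[of m] show False by simp
  qed
qed


section \<open>The integral of the kernel over the torus\<close>

lemma Re_cayley_nonneg:
  fixes c :: real and x :: complex
  assumes "cmod x \<le> c"
  shows "0 \<le> Re ((c + x) / (c - x))"
  unfolding Re_cayley using assms by (intro divide_nonneg_nonneg) (auto intro: power_mono)

lemma cmod_le_1_Re_eq_1D:
  assumes "cmod z \<le> 1" "Re z = 1"
  shows "z = 1"
proof -
  have "(cmod z)\<^sup>2 \<le> 1" using assms(1) by (simp add: power_le_one)
  then show ?thesis using assms(2) by (simp add: cmod_power2 complex_eq_iff)
qed

text \<open>Both real parts are at most 1 and add up to 2. Hence the denominator
  \<open>2 - (w + z)\<close> vanishes on the closed bidisc only at the point (1, 1).\<close>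

lemma sum_eq_2_unit_discD:
  assumes "cmod w \<le> 1" "cmod z \<le> 1" "w + z = 2"
  shows "w = 1"
proof (rule cmod_le_1_Re_eq_1D)
  have "Re w + Re z = 2" using arg_cong[OF assms(3), of Re] by simp
  then show "Re w = 1"
    using assms(1,2) abs_Re_le_cmod[of w] abs_Re_le_cmod[of z] by linarith
qed fact

text \<open>The exceptional set is a countable union of hyperplanes orthogonal to \<open>p\<close>,
  one for each integer multiple of \<open>2 * pi\<close>.\<close>

lemma AE_lborel_cis_inner_neq_1:
  fixes p :: "'a::euclidean_space"
  assumes "p \<in> Basis"
  shows "AE t in lborel. cis (t \<bullet> p) \<noteq> 1"
proof -
  have "AE t in lborel. \<forall>n::int. t \<bullet> p \<noteq> of_int n * (2 * pi)"
    by (subst AE_all_countable) (use AE_lborel_inner_neq[OF assms] in blast)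
  then show ?thesis
    by eventually_elim (auto simp: cis_eq_1_iff)
qed

lemma nn_integral_torus_Re_cayley:
  fixes p q v :: "'a::euclidean_space"
  assumes "p \<in> Basis" "q \<in> Basis" "p \<noteq> q" and v: "\<And>b. b \<in> Basis \<Longrightarrow> v \<bullet> b = 2 * pi"
  shows "(\<integral>\<^sup>+t. ennreal (Re ((2 + (cis (t \<bullet> p) + cis (t \<bullet> q))) / (2 - (cis (t \<bullet> p) + cis (t \<bullet> q)))))
      * indicator (cbox 0 v) t \<partial>lborel) = ennreal ((2 * pi) ^ DIM('a))"
proof -
  define P where "P y z = Re ((2 + (cis y + cis z)) / (2 - (cis y + cis z)))" for y z
  have P: "0 \<le> P y z" for y z
    unfolding P_def using Re_cayley_nonneg[of "cis y + cis z" 2] norm_triangle_ineq[of "cis y" "cis z"]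
    by simp
  have [measurable]: "cis \<in> borel_measurable borel"
    by (intro borel_measurable_continuous_onI continuous_intros)
  have meas: "(\<lambda>(y, z). ennreal (P y z)) \<in> borel_measurable borel"
    unfolding P_def borel_prod[symmetric] by measurable
  have inner: "(\<integral>\<^sup>+z. ennreal (P y z) * indicator {0..2 * pi} z \<partial>lborel)
      = ennreal (2 * pi * Re ((2 + cis y) / (2 - cis y)))" if y: "cis y \<noteq> 1" for y
  proof -
    \<comment> \<open>Excluding \<open>cis y = 1\<close> keeps the pole \<open>2 - cis y\<close> off
      the closed disc, boundary included.\<close>
    have "2 - (cis y + w) \<noteq> 0" if "w \<in> cball 0 1" for w
      using sum_eq_2_unit_discD[of "cis y" w] y that by auto
    then have "(\<lambda>w. (2 + (cis y + w)) / (2 - (cis y + w))) holomorphic_on cball 0 1"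
      by (intro holomorphic_intros) auto
    from nn_integral_circle_mean[OF this] P[of y] show ?thesis
      by (simp add: P_def)
  qed
  have nn2: "0 \<le> Re ((2 + cis y) / (2 - cis y))" for y
    using Re_cayley_nonneg[of "cis y" 2] by simp
  have "(\<integral>\<^sup>+y. (\<integral>\<^sup>+z. ennreal (P y z) * indicator {0..2 * pi} z \<partial>lborel) * indicator {0..2 * pi} y \<partial>lborel)
      = (\<integral>\<^sup>+y. ennreal (2 * pi) * (ennreal (Re ((2 + cis y) / (2 - cis y))) * indicator {0..2 * pi} y) \<partial>lborel)"
    using AE_lborel_cis_inner_neq_1[of "1::real"]
    by (intro nn_integral_cong_AE) (auto simp: inner ennreal_mult nn2 mult.assoc)
  also have "\<dots> = ennreal (2 * pi) * (\<integral>\<^sup>+y. ennreal (Re ((2 + cis y) / (2 - cis y))) * indicator {0..2 * pi} y \<partial>lborel)"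
    by (rule nn_integral_cmult) measurable
  also have "(\<integral>\<^sup>+y. ennreal (Re ((2 + cis y) / (2 - cis y))) * indicator {0..2 * pi} y \<partial>lborel) = ennreal (2 * pi)"
  proof -
    \<comment> \<open>Now the pole is at 2 and the value at the centre is 1.\<close>
    have "(\<lambda>w. (2 + w) / (2 - w) :: complex) holomorphic_on cball 0 1"
      by (intro holomorphic_intros) auto
    from nn_integral_circle_mean[OF this] nn2 show ?thesis by simp
  qed
  finally have two: "(\<integral>\<^sup>+y. (\<integral>\<^sup>+z. ennreal (P y z) * indicator {0..2 * pi} z \<partial>lborel)
      * indicator {0..2 * pi} y \<partial>lborel) = ennreal ((2 * pi)\<^sup>2)"
    by (simp add: ennreal_mult[symmetric] power2_eq_square)
  have card: "card (Basis - {p, q}) + 2 = DIM('a)"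
    using assms(1-3) card_mono[of Basis "{p, q}"] by (simp add: card_Diff_subset)
  have "(\<integral>\<^sup>+t. ennreal (P (t \<bullet> p) (t \<bullet> q)) * indicator (cbox 0 v) t \<partial>lborel) =
      ennreal ((2 * pi)\<^sup>2) * (\<Prod>b\<in>Basis - {p, q}. ennreal (2 * pi))"
    using nn_integral_cbox_two_coords[OF assms(1-3) meas, of 0 v] assms(1,2)
    by (simp add: v two)
  also have "\<dots> = ennreal ((2 * pi) ^ DIM('a))"
    unfolding card[symmetric] by (simp add: ennreal_power ennreal_mult[symmetric] power_add mult_ac power2_eq_square)
  finally show ?thesis by (simp add: P_def)
qed

section \<open>Nontangential limits and boundary values\<close>

text \<open>The radius ending at \<open>w\<close> stays in a Stolz region, so the filter is proper
  and limits along it are unique; this is what lets \<open>Lim\<close> be evaluated in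
  \<open>boundary_value\<close>.\<close>

lemma nontangential_neq_bot:
  fixes w :: "complex ^ 'n::finite"
  assumes w: "\<And>i. cmod (w $ i) = 1"
  shows "nontangential w \<noteq> bot"
proof
  assume "nontangential w = bot"
  \<comment> \<open>A supremum of filters is trivial only if every member is, so testing aperture 2
    suffices.\<close>
  then have bot: "at w within stolz 2 w = bot"
    unfolding nontangential_def SUP_bot_conv by auto
  have "filterlim (\<lambda>r. r *\<^sub>R w) (at w within stolz 2 w) (at_left (1::real))"
    unfolding filterlim_at
  proof
    have "((\<lambda>r. r *\<^sub>R w) \<longlongrightarrow> 1 *\<^sub>R w) (at_left (1::real))"
      by (intro tendsto_intros)
    then show "((\<lambda>r. r *\<^sub>R w) \<longlongrightarrow> w) (at_left (1::real))" by simp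
    have "r *\<^sub>R w \<in> stolz 2 w \<and> r *\<^sub>R w \<noteq> w" if r: "0 < r" "r < 1" for r
    proof
      have "cmod (r *\<^sub>R (w $ i) - w $ i) = 1 - r" for i
        using norm_scaleR[of "r - 1" "w $ i"] r by (simp add: w scaleR_diff_left)
      then show "r *\<^sub>R w \<in> stolz 2 w"
        using r by (simp add: stolz_def polydisc_def w)
      have "w \<noteq> 0" using w[of undefined] by auto
      then show "r *\<^sub>R w \<noteq> w"
        using r scaleR_right_imp_eq[of w r 1] by auto
    qed
    then show "\<forall>\<^sub>F r in at_left 1. r *\<^sub>R w \<in> stolz 2 w \<and> r *\<^sub>R w \<noteq> w"
      unfolding eventually_at_left_field by (intro exI[of _ 0]) auto
  qed
  then have "filtermap (\<lambda>r. r *\<^sub>R w) (at_left (1::real)) = bot"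
    unfolding bot filterlim_def by (simp add: bot_unique)
  then show False by (simp add: filtermap_bot_iff)
qed

text \<open>Stolz regions lie in the polydisc, so agreement of \<open>G\<close> and \<open>f\<close>
  there is enough, and full continuity of \<open>f\<close> at \<open>w\<close> covers unrelated
  rates of approach.\<close>

lemma tendsto_nontangentialI:
  assumes "isCont f w" "\<And>z. z \<in> polydisc \<Longrightarrow> G z = f z"
  shows "(G \<longlongrightarrow> f w) (nontangential w)"
  unfolding tendsto_nontangential_iff
proof (intro allI impI)
  fix M :: real
  have "(f \<longlongrightarrow> f w) (at w within stolz M w)"
    using assms(1) by (auto simp: isCont_def intro: tendsto_within_subset)
  moreover have "\<forall>\<^sub>F z in at w within stolz M w. f z = G z"
    unfolding eventually_at_filter using assms(2) by (auto simp: stolz_def)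
  ultimately show "(G \<longlongrightarrow> f w) (at w within stolz M w)"
    by (rule Lim_transform_eventually)
qed

lemma boundary_value_eq:
  assumes "isCont f w" "\<And>z. z \<in> polydisc \<Longrightarrow> G z = f z" "\<And>i. cmod (w $ i) = 1"
  shows "boundary_value G w = f w"
  unfolding boundary_value_def
  using nontangential_neq_bot[of w] tendsto_nontangentialI[OF assms(1,2)] assms(3)
  by (intro tendsto_Lim) auto

section \<open>Restriction to the diagonal and failure of strong outerness\<close>

text \<open>Chain rule with the linear diagonal embedding; complex linearity of the derivative turns
  it into multiplication by its value at the all-ones vector.\<close>

lemma holomorphic_multi_imp_holomorphic_diagonal:
  fixes G :: "complex ^ 'n::finite \<Rightarrow> complex"
  assumes "holomorphic_multi polydisc G"
  shows "(\<lambda>z. G (\<chi> i. z)) holomorphic_on ball 0 1"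
  unfolding holomorphic_on_open[OF open_ball]
proof
  fix z :: complex assume "z \<in> ball 0 1"
  then have "(\<chi> i. z) \<in> (polydisc :: (complex ^ 'n) set)" by (simp add: polydisc_def)
  then obtain D where D: "(G has_derivative D) (at (\<chi> i. z))" "\<And>c v. D (c *s v) = c * D v"
    using assms unfolding holomorphic_multi_def by blast
  have "linear (\<lambda>z. (\<chi> i. z) :: complex ^ 'n)"
    by (auto intro!: linearI simp: vec_eq_iff)
  then have "((\<lambda>z. (\<chi> i. z) :: complex ^ 'n) has_derivative (\<lambda>z. \<chi> i. z)) (at z)"
    by (simp add: linear_imp_has_derivative)
  from diff_chain_at[OF this D(1)]
  have "((\<lambda>z. G (\<chi> i. z)) has_derivative (\<lambda>h. D (\<chi> i. h))) (at z)"
    by (simp add: o_def)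
  moreover have "(\<lambda>h. D (\<chi> i. h)) = (*) (D (\<chi> i. 1))"
  proof
    show "D (\<chi> i. h) = D (\<chi> i. 1) * h" for h
      using D(2)[of h "\<chi> i. 1"] by (simp add: vector_scalar_mult_def mult.commute)
  qed
  ultimately show "\<exists>d. ((\<lambda>z. G (\<chi> i. z)) has_field_derivative d) (at z)"
    unfolding has_field_derivative_def by metis
qed

lemma not_strongly_outer_of_diagonal:
  fixes F :: "complex ^ 'n::finite \<Rightarrow> complex"
  assumes F: "\<And>z. z \<in> ball 0 1 \<Longrightarrow> F (\<chi> i. z) = exp ((z + 1) / (z - 1))"
  shows "\<not> strongly_outer polydisc F"
proof
  assume "strongly_outer polydisc F"
  then obtain Fn where inv: "\<And>n. n \<ge> 1 \<Longrightarrow> Hinf_invertible polydisc (Fn n)"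
    and le: "\<And>z n. z \<in> polydisc \<Longrightarrow> n \<ge> 1 \<Longrightarrow> cmod (F z) \<le> cmod (Fn n z)"
    and lim: "\<And>z. z \<in> polydisc \<Longrightarrow> (\<lambda>n. F z * inverse (Fn n z)) \<longlonglongrightarrow> 1"
    unfolding strongly_outer_def by metis
  have diag: "(\<chi> i. z) \<in> (polydisc :: (complex ^ 'n) set)" if "z \<in> ball 0 1" for z
    using that by (simp add: polydisc_def)
  have F0: "cmod (F (\<chi> i. 0)) = exp (-1)" by (simp add: F)
  have bound: "cmod (F (\<chi> i. 0) * inverse (Fn n (\<chi> i. 0))) \<le> exp (-1)" if n: "n \<ge> 1" for n
  proof -
    obtain g where g: "holomorphic_multi polydisc g" "bounded (g ` polydisc)"
      and Fg: "\<And>z. z \<in> polydisc \<Longrightarrow> Fn n z * g z = 1"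
      using inv[OF n] by (auto simp: Hinf_invertible_def Hinf_def)
    obtain C where C: "\<And>z. z \<in> polydisc \<Longrightarrow> cmod (g z) \<le> C"
      using g(2) by (auto simp: bounded_iff)
    have ginv: "g z = inverse (Fn n z)" if "z \<in> polydisc" for z
      using Fg[OF that] by (metis inverse_unique)
    \<comment> \<open>Invertibility makes \<open>g\<close>, the reciprocal of \<open>Fn n\<close>,
      bounded, and the domination of \<open>F\<close> by \<open>Fn n\<close> turns into the Poisson
      bound on \<open>g\<close>.\<close>
    have "cmod (g (\<chi> i. 0)) \<le> 1"
    proof (rule norm_le_one_of_le_exp_Poisson[where g="\<lambda>z. g (\<chi> i. z)"])
      show "(\<lambda>z. g (\<chi> i. z)) holomorphic_on ball 0 1"
        using g(1) by (rule holomorphic_multi_imp_holomorphic_diagonal)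
      fix z :: complex assume z: "z \<in> ball 0 1"
      show "cmod (g (\<chi> i. z)) \<le> C" using C diag z by blast
      have "(z + 1) / (z - 1) = - ((1 + z) / (1 - z))"
        using z by (metis add.commute minus_diff_eq minus_divide_right)
      then have "cmod (F (\<chi> i. z)) = inverse (exp (Re ((1 + z) / (1 - z))))"
        using F[OF z] norm_exp_eq_Re by (simp add: norm_inverse exp_minus)
      then have "inverse (exp (Re ((1 + z) / (1 - z)))) \<le> cmod (Fn n (\<chi> i. z))"
        using le[OF diag[OF z] n] by simp
      then show "cmod (g (\<chi> i. z)) \<le> exp (Re ((1 + z) / (1 - z)))"
        using le_imp_inverse_le[of "inverse (exp (Re ((1 + z) / (1 - z))))" "cmod (Fn n (\<chi> i. z))"]
        by (simp add: ginv[OF diag[OF z]] norm_inverse)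
    qed
    then show ?thesis
      using ginv[OF diag[of 0]] by (simp add: norm_mult F0)
  qed
  \<comment> \<open>The required limit 1 already fails at the origin, where every quotient with
    \<open>n \<ge> 1\<close> has modulus at most \<open>exp (-1)\<close>.\<close>
  have "(\<lambda>n. cmod (F (\<chi> i. 0) * inverse (Fn n (\<chi> i. 0)))) \<longlonglongrightarrow> cmod 1"
    by (intro tendsto_norm lim diag) simp
  then have "cmod 1 \<le> exp (-1)"
    using bound by (intro LIMSEQ_le_const2) auto
  then show False by simp
qed

section \<open>Holomorphy and outerness\<close>

lemma cis_torus_point: "torus_point t $ i = cis (t $ i)"
  by (simp add: torus_point_def)

lemma holomorphic_multi_sum_coords:
  fixes a b :: "'n::finite" and F :: "complex ^ 'n \<Rightarrow> complex"
  assumes U: "open U" and f: "f holomorphic_on V" "open V"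
    and V: "\<And>z. z \<in> U \<Longrightarrow> z $ a + z $ b \<in> V"
    and F: "\<And>z. z \<in> U \<Longrightarrow> F z = f (z $ a + z $ b)"
  shows "holomorphic_multi U F"
  unfolding holomorphic_multi_def
proof
  fix z assume z: "z \<in> U"
  define d where "d = deriv f (z $ a + z $ b)"
  have "(f has_derivative (*) d) (at (z $ a + z $ b))"
    using holomorphic_derivI[OF f V[OF z]] by (simp add: d_def has_field_derivative_def)
  moreover have "((\<lambda>z. z $ a + z $ b) has_derivative (\<lambda>v. v $ a + v $ b)) (at z)"
    by (intro bounded_linear_imp_has_derivative bounded_linear_add bounded_linear_vec_nth)
  ultimately have "((\<lambda>z. f (z $ a + z $ b)) has_derivative (\<lambda>v. d * (v $ a + v $ b))) (at z)"
    using diff_chain_at[of "\<lambda>z. z $ a + z $ b"] by (fastforce simp: o_def)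
  then have "(F has_derivative (\<lambda>v. d * (v $ a + v $ b))) (at z)"
    by (rule has_derivative_transform_within_open[OF _ U z]) (simp add: F)
  then show "\<exists>D. (F has_derivative D) (at z) \<and> (\<forall>c v. D (c *s v) = c * D v)"
    by (auto intro!: exI[of _ "\<lambda>v. d * (v $ a + v $ b)"] simp: algebra_simps)
qed

text \<open>Off the null set where \<open>cis (t $ a) = 1\<close> the formula for \<open>F\<close>
  is continuous at the torus point. The boundary value is then explicit, and its log modulus is
  minus the kernel integrated in \<open>nn_integral_torus_Re_cayley\<close>.\<close>

lemma outer_fun_exp_neg_cayley:
  fixes a b :: "'n::finite" and F :: "complex ^ 'n \<Rightarrow> complex"
  assumes ab: "a \<noteq> b"
    and F: "\<And>z. z \<in> polydisc \<Longrightarrow> F z = exp (- ((2 + (z $ a + z $ b)) / (2 - (z $ a + z $ b))))"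
  shows "outer_fun F"
proof -
  define P where "P t = Re ((2 + (cis (t $ a) + cis (t $ b))) / (2 - (cis (t $ a) + cis (t $ b))))"
    for t :: "real ^ 'n"
  define B where "B = cbox 0 (\<chi> j. 2 * pi :: real ^ 'n)"
  define L where "L t = ln (cmod (boundary_value F (torus_point t)))" for t :: "real ^ 'n"
  have Ppos: "0 \<le> P t" for t
    unfolding P_def
    using Re_cayley_nonneg[of "cis (t $ a) + cis (t $ b)" 2]
      norm_triangle_ineq[of "cis (t $ a)" "cis (t $ b)"] by simp
  have lt2: "cmod (z $ a + z $ b) < 2" if "z \<in> polydisc" for z
  proof -
    have "cmod (z $ i) < 1" for i using that by (simp add: polydisc_def)
    from this[of a] this[of b] norm_triangle_ineq[of "z $ a" "z $ b"] show ?thesis by linarith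
  qed
  have hol: "F \<in> Hinf polydisc"
  proof -
    have "holomorphic_multi polydisc F"
    proof (rule holomorphic_multi_sum_coords[OF open_polydisc _ open_ball])
      show "(\<lambda>w. exp (- ((2 + w) / (2 - w)))) holomorphic_on ball 0 2"
        by (intro holomorphic_intros) auto
    qed (use lt2 F in auto)
    moreover have "cmod (F z) \<le> 1" if "z \<in> polydisc" for z
      using Re_cayley_nonneg[of "z $ a + z $ b" 2] lt2[OF that] by (simp add: F that)
    ultimately show ?thesis by (auto simp: Hinf_def bounded_iff)
  qed
  have F0: "F 0 = exp (-1)" by (simp add: F polydisc_def)
  have ae: "AE t in lebesgue. cis (t $ a) \<noteq> 1"
    using AE_lborel_cis_inner_neq_1[of "axis a (1::real)"]
    by (intro AE_completion) (simp add: cart_eq_inner_axis axis_in_Basis_iff)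
  have cont: "isCont (\<lambda>z. exp (- ((2 + (z $ a + z $ b)) / (2 - (z $ a + z $ b))))) (torus_point t)"
    if "cis (t $ a) \<noteq> 1" for t :: "real ^ 'n"
  proof -
    have "2 - (cis (t $ a) + cis (t $ b)) \<noteq> 0"
      using sum_eq_2_unit_discD[of "cis (t $ a)" "cis (t $ b)"] that by auto
    then show ?thesis
      unfolding isCont_def by (intro tendsto_intros) (simp add: cis_torus_point)
  qed
  have lim: "AE t in lebesgue. \<exists>l. (F \<longlongrightarrow> l) (nontangential (torus_point t))"
    using ae by eventually_elim (rule exI, rule tendsto_nontangentialI[OF cont F])
  have L: "AE t in lebesgue. - P t = L t"
    using ae
  proof eventually_elim
    case (elim t)
    show ?case
      unfolding L_def P_def
      by (subst boundary_value_eq[OF cont[OF elim] F]) (auto simp: cis_torus_point)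
  qed
  have [measurable]: "cis \<in> borel_measurable borel"
    by (intro borel_measurable_continuous_onI continuous_intros)
  have [measurable]: "P \<in> borel_measurable borel"
    unfolding P_def by measurable
  have [measurable]: "B \<in> sets borel" by (simp add: B_def)
  have nn: "(\<integral>\<^sup>+t. ennreal (indicator B t * P t) \<partial>lborel) = ennreal ((2 * pi) ^ CARD('n))"
  proof -
    have *: "axis a 1 \<noteq> (axis b 1 :: real ^ 'n)" using ab by (simp add: axis_eq_axis)
    have "(\<chi> j. 2 * pi :: real ^ 'n) \<bullet> k = 2 * pi" if "k \<in> Basis" for k
      using that by (auto simp: Basis_vec_def inner_axis)
    from nn_integral_torus_Re_cayley[OF _ _ * this]
    have "(\<integral>\<^sup>+t. ennreal (P t) * indicator B t \<partial>lborel) = ennreal ((2 * pi) ^ CARD('n))"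
      by (simp add: P_def B_def cart_eq_inner_axis[symmetric] axis_in_Basis_iff)
    then show ?thesis
      by (simp add: ennreal_mult' mult.commute ennreal_indicator Ppos)
  qed
  \<comment> \<open>For a nonnegative measurable function a finite \<open>nn_integral\<close> gives
    integrability and the value at once.\<close>
  have "has_bochner_integral lborel (\<lambda>t. indicator B t * P t) ((2 * pi) ^ CARD('n))"
    by (rule has_bochner_integral_nn_integral) (use nn Ppos in auto)
  then have "has_bochner_integral lborel (\<lambda>t. - (indicator B t * P t)) (- ((2 * pi) ^ CARD('n)))"
    by (rule has_bochner_integral_minus)
  then have "has_bochner_integral lebesgue (\<lambda>t. - (indicator B t * P t)) (- ((2 * pi) ^ CARD('n)))"
    by (simp add: has_bochner_integral_iff integrable_completion integral_completion)
  moreover have ae': "AE t in lebesgue. - (indicator B t * P t) = indicator B t * L t"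
    using L by eventually_elim (auto simp: indicator_def)
  \<comment> \<open>\<open>L\<close> is built from \<open>Lim\<close>, so its measurability is drawn
    from the almost everywhere identity with \<open>- P\<close> and the completeness of
    \<open>lebesgue\<close>.\<close>
  moreover have "(\<lambda>t. indicator B t * L t) \<in> borel_measurable lebesgue"
    by (rule completion.measurable_AE_eq[OF _ ae']) (auto intro: measurable_completion)
  ultimately have "has_bochner_integral lebesgue (\<lambda>t. indicator B t * L t) (- ((2 * pi) ^ CARD('n)))"
    by (subst has_bochner_integral_cong_AE[of _ _ "\<lambda>t. - (indicator B t * P t)"])
      (auto intro: measurable_completion)
  then have int: "set_integrable lebesgue B L" "(LINT t:B|lebesgue. L t) = - ((2 * pi) ^ CARD('n))"
    by (auto simp: has_bochner_integral_iff set_integrable_def set_lebesgue_integral_def)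
  \<comment> \<open>After normalisation the integral is -1, which is the logarithm of
    \<open>cmod (F 0) = exp (-1)\<close>.\<close>
  show ?thesis
    unfolding outer_fun_def
    using hol F0 lim int by (simp add: L_def[abs_def] B_def)
qed

theorem proposition12p7:
  fixes a b :: "'n::finite"
    and F :: "complex ^ 'n \<Rightarrow> complex"
  assumes "CARD('n) \<ge> 2"
    and "a \<noteq> b"
    and "\<And>z. z \<in> polydisc \<Longrightarrow> F z = exp ((z $ a + z $ b + 2) / (z $ a + z $ b - 2))"
  shows "outer_fun F \<and> \<not> strongly_outer polydisc F"
proof
  have "(x + 2) / (x - 2) = - ((2 + x) / (2 - x))" for x :: complex
    by (metis add.commute minus_diff_eq minus_divide_right)
  then show "outer_fun F"
    by (intro outer_fun_exp_neg_cayley[OF assms(2)]) (simp only: assms(3))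
  show "\<not> strongly_outer polydisc F"
  proof (rule not_strongly_outer_of_diagonal)
    fix z :: complex assume "z \<in> ball 0 1"
    then have "F (\<chi> i. z) = exp ((z + z + 2) / (z + z - 2))"
      by (subst assms(3)) (auto simp: polydisc_def)
    \<comment> \<open>On the diagonal the common factor 2 cancels, which leaves the exponent of the
      singular inner function.\<close>
    also have "(z + z + 2) / (z + z - 2) = (2 * (z + 1)) / (2 * (z - 1))"
      by (simp add: algebra_simps)
    also have "\<dots> = (z + 1) / (z - 1)" by (rule mult_divide_mult_cancel_left) simp
    finally show "F (\<chi> i. z) = exp ((z + 1) / (z - 1))" .
  qed
qed

end
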